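(* The following ones are the only complete normed Abelian groups that have collinear zero-mean triples, up to rescaling of their norm by a constant factor: - $\mathbb R$ with the Archimedean norm; - $\mathbb Z$ with the Archimedean norm; - $\mathbb Z_2$; - $\mathbb Z_4$ with norm satisfying $|1|=1$, $|2|=2$; - $\mathbb Z_2\times\mathbb Z_2$ with norm satisfying $|(1,0)|=1$, $|(0,1)|=\alpha$, $|(1,1)|=1+\alpha$ for any choice of $\alpha\ge 1$.
   Context: A normed Abelian group $(G,|\cdot|)$ is an Abelian group $G$ with a function $|\cdot|:G\to\mathbb R_{\ge 0}$ such that $|g+h|\le |g|+|h|$ and $|-g|=|g|$ for all $g,h\in G$, and $|g|=0$ if and only if $g=0$. It is complete if it is complete for the metric $(g,h)\mapsto|g-h|$. Groups are identified if there is a norm-preserving group isomorphism between them. $\mathbb Z_n=\mathbb Z/n\mathbb Z$. The Archimedean norm is the usual absolute value. All norms on $\mathbb Z_2$ agree up to a constant factor. Elements $a,b,c\in G$ form a zero-mean triple if $a+b+c=0$. A triple is collinear if one of $|a|+|b|=|c|$, $|a|+|c|=|b|$, $|b|+|c|=|a|$ holds. $(G,|\cdot|)$ has collinear zero-mean triples if all zero-mean triples are collinear.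
   Formalization: The classification is stated for groups with a nonzero element: the trivial group {0} is a complete normed Abelian group with collinear zero-mean triples but is missing from the list, so the literal claim fails for it alone. *)

theory Defs
  imports "HOL-Analysis.Analysis"
begin

text \<open>
  The norm is a parameter rather than a type class operation, since the groups
  \<open>\<int>\<^sub>2\<close>, \<open>\<int>\<^sub>4\<close> and \<open>\<int>\<^sub>2 \<times> \<int>\<^sub>2\<close> have no norm attached to their types.
\<close>

locale normed_abelian_group =
  fixes N :: "'a::ab_group_add \<Rightarrow> real"
  assumes norm_nonneg: "0 \<le> N g"
    and norm_triangle: "N (g + h) \<le> N g + N h"
    and norm_minus: "N (- g) = N g"
    and norm_eq_zero: "N g = 0 \<longleftrightarrow> g = 0"

definition norm_metric :: "('a::ab_group_add \<Rightarrow> real) \<Rightarrow> 'a \<Rightarrow> 'a \<Rightarrow> real"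
  where "norm_metric N g h = N (g - h)"

sublocale normed_abelian_group \<subseteq> Metric_space UNIV "norm_metric N"
proof
  fix g h k :: 'a
  show "0 \<le> norm_metric N g h"
    by (simp add: norm_metric_def norm_nonneg)
  show "norm_metric N g h = norm_metric N h g"
    using norm_minus[of "g - h"] by (simp add: norm_metric_def)
  show "norm_metric N g h = 0 \<longleftrightarrow> g = h"
    by (simp add: norm_metric_def norm_eq_zero)
  show "norm_metric N g k \<le> norm_metric N g h + norm_metric N h k"
    using norm_triangle[of "g - h" "h - k"] by (simp add: norm_metric_def)
qed

definition complete_normed_abelian_group :: "('a::ab_group_add \<Rightarrow> real) \<Rightarrow> bool"
  where "complete_normed_abelian_group N \<longleftrightarrow>
    normed_abelian_group N \<and> Metric_space.mcomplete UNIV (norm_metric N)"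

definition zero_mean_triple :: "'a::ab_group_add \<Rightarrow> 'a \<Rightarrow> 'a \<Rightarrow> bool"
  where "zero_mean_triple a b c \<longleftrightarrow> a + b + c = 0"

definition collinear_triple :: "('a::ab_group_add \<Rightarrow> real) \<Rightarrow> 'a \<Rightarrow> 'a \<Rightarrow> 'a \<Rightarrow> bool"
  where "collinear_triple N a b c \<longleftrightarrow>
    N a + N b = N c \<or> N a + N c = N b \<or> N b + N c = N a"

definition collinear_zero_mean_triples :: "('a::ab_group_add \<Rightarrow> real) \<Rightarrow> bool"
  where "collinear_zero_mean_triples N \<longleftrightarrow>
    (\<forall>a b c. zero_mean_triple a b c \<longrightarrow> collinear_triple N a b c)"

definition norm_isomorphic ::
    "('a::ab_group_add \<Rightarrow> real) \<Rightarrow> ('b::ab_group_add \<Rightarrow> real) \<Rightarrow> bool"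
  where "norm_isomorphic N M \<longleftrightarrow>
    (\<exists>f. Modules.additive f \<and> bij f \<and> (\<forall>g. M (f g) = N g))"

definition norm_isomorphic_up_to_scaling ::
    "('a::ab_group_add \<Rightarrow> real) \<Rightarrow> ('b::ab_group_add \<Rightarrow> real) \<Rightarrow> bool"
  where "norm_isomorphic_up_to_scaling N M \<longleftrightarrow>
    (\<exists>c>0. norm_isomorphic (\<lambda>g. c * N g) M)"

text \<open>
  The types \<^typ>\<open>2\<close> and \<^typ>\<open>4\<close> of \<^theory>\<open>HOL-Library.Numeral_Type\<close> carry arithmetic
  modulo 2 and 4, and \<^typ>\<open>2 \<times> 2\<close> is a group under componentwise addition. On each of
  \<^typ>\<open>4\<close> and \<^typ>\<open>2 \<times> 2\<close> the values prescribed below determine the norm.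
\<close>

definition is_norm_Z4 :: "(4 \<Rightarrow> real) \<Rightarrow> bool"
  where "is_norm_Z4 M \<longleftrightarrow> normed_abelian_group M \<and> M 1 = 1 \<and> M 2 = 2"

definition is_norm_Z2xZ2 :: "real \<Rightarrow> (2 \<times> 2 \<Rightarrow> real) \<Rightarrow> bool"
  where "is_norm_Z2xZ2 \<alpha> M \<longleftrightarrow>
    normed_abelian_group M \<and> M (1, 0) = 1 \<and> M (0, 1) = \<alpha> \<and> M (1, 1) = 1 + \<alpha>"

end

theory Submission
  imports Defs
begin

text \<open>
  Substituting \<open>c = - (a + b)\<close>, collinearity of all zero-mean triples says that \<open>|a + b|\<close> is always
  either \<open>|a| + |b|\<close> or \<open>||a| - |b||\<close>. In particular \<open>|2a|\<close> is \<open>2|a|\<close> or \<open>0\<close>, and the classification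
  is governed by how soon the multiples of an element vanish.

  If \<open>4a \<noteq> 0\<close> for some \<open>a\<close>, then the alternatives for sums of small multiples force \<open>|na| = n|a|\<close>, so
  the multiples of \<open>a\<close> form a geodesic ray. Its Busemann function \<open>f g = lim (|g + na| - n|a|)\<close> is
  subadditive as a limit of norms. Each term is \<open>|g|\<close> or \<open>- |g|\<close> once \<open>n\<close> is large, so \<open>|f g| = |g|\<close>.
  It is impossible that \<open>f g = f (- g) = |g| > 0\<close>: then \<open>g + a\<close> and \<open>- g + a\<close> would both have norm
  \<open>|g| + |a|\<close>, so that their sum \<open>2a\<close> would have norm \<open>0\<close> or \<open>2|g| + 2|a|\<close>. Thus \<open>f\<close> is odd, and being
  subadditive it is additive. This embeds the group isometrically in the reals
  (\<open>isometric_additive_real\<close>), completeness makes the image closed, and a nonzero closed subgroup of the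
  reals is everything or infinite cyclic (\<open>closed_additive_range_cases\<close>).

  If \<open>4g = 0\<close> for all \<open>g\<close>, but some \<open>a\<close> has order 4, then any element of order 2 has the norm of \<open>2a\<close>.
  Two different elements of order 2 would therefore have a sum whose norm is neither the sum nor the
  difference of theirs, so \<open>2a\<close> is the only one and the group is cyclic of order 4
  (\<open>exponent_four_elements\<close>).

  If \<open>2g = 0\<close> for all \<open>g\<close>, the group is a vector space over the field with two elements, and its
  dimension is at most 2: the seven nonzero points of a three-dimensional space form a Fano plane in
  which every line would have to contain a point whose norm is the sum of the other two norms. What this says
  about the lines through a point of largest norm contradicts what it says about the other four lines
  (\<open>exponent_two_no_maximum\<close>).
\<close>

section \<open>Completeness and collinearity in terms of the norm\<close>

lemma complete_normed_abelian_group_iff: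
  "complete_normed_abelian_group N \<longleftrightarrow> normed_abelian_group N \<and>
    (\<forall>\<sigma>::nat \<Rightarrow> _. (\<forall>e>0. \<exists>K. \<forall>m\<ge>K. \<forall>n\<ge>K. N (\<sigma> m - \<sigma> n) < e) \<longrightarrow>
      (\<exists>l. \<forall>e>0. \<exists>K. \<forall>n\<ge>K. N (\<sigma> n - l) < e))"
proof (cases "normed_abelian_group N")
  case True
  then interpret normed_abelian_group N .
  show ?thesis
    unfolding complete_normed_abelian_group_def mcomplete_def MCauchy_def limit_metric_sequentially
    using True by (simp add: norm_metric_def)
qed (simp add: complete_normed_abelian_group_def)

text \<open>
  Norms bounded away from zero make every Cauchy sequence eventually constant. This covers the integers
  and all finite groups.
\<close>

lemma complete_if_discrete:
  assumes "normed_abelian_group N" "e > 0" and discrete: "\<And>g. N g < e \<Longrightarrow> g = 0"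
  shows "complete_normed_abelian_group N"
  unfolding complete_normed_abelian_group_iff
proof (intro conjI allI impI)
  interpret normed_abelian_group N by fact
  fix \<sigma> :: "nat \<Rightarrow> 'a"
  assume "\<forall>e>0. \<exists>K. \<forall>m\<ge>K. \<forall>n\<ge>K. N (\<sigma> m - \<sigma> n) < e"
  then obtain K where "\<And>m n. m \<ge> K \<Longrightarrow> n \<ge> K \<Longrightarrow> N (\<sigma> m - \<sigma> n) < e"
    using \<open>e > 0\<close> by blast
  then have "\<sigma> n - \<sigma> K = 0" if "n \<ge> K" for n
    using that discrete by blast
  then show "\<exists>l. \<forall>e>0. \<exists>K. \<forall>n\<ge>K. N (\<sigma> n - l) < e"
    using norm_eq_zero by (metis (no_types))
qed fact

lemma complete_if_finite:
  fixes N :: "'a::{ab_group_add,finite} \<Rightarrow> real"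
  assumes "normed_abelian_group N"
  shows "complete_normed_abelian_group N"
proof (rule complete_if_discrete[OF assms])
  interpret normed_abelian_group N by fact
  define e where "e = Min (insert 1 (N ` (- {0})))"
  show "e > 0"
    unfolding e_def by (subst Min_gr_iff) (auto simp: norm_eq_zero less_le norm_nonneg)
  show "g = 0" if "N g < e" for g
  proof (rule ccontr)
    assume "g \<noteq> 0"
    then have "e \<le> N g" unfolding e_def by (intro Min_le) auto
    with that show False by simp
  qed
qed

context normed_abelian_group
begin

lemma collinear_zero_mean_triples_iff:
  "collinear_zero_mean_triples N \<longleftrightarrow>
    (\<forall>a b. N (a + b) = N a + N b \<or> N (a + b) = \<bar>N a - N b\<bar>)"
proof -
  have "zero_mean_triple a b c \<longleftrightarrow> c = - (a + b)" for a b c :: 'a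
    unfolding zero_mean_triple_def by (metis add_eq_0_iff)
  then have "collinear_zero_mean_triples N \<longleftrightarrow> (\<forall>a b. collinear_triple N a b (- (a + b)))"
    unfolding collinear_zero_mean_triples_def by simp
  moreover have "collinear_triple N a b (- (a + b)) \<longleftrightarrow>
      N (a + b) = N a + N b \<or> N (a + b) = \<bar>N a - N b\<bar>" for a b
    unfolding collinear_triple_def norm_minus
    using norm_nonneg[of a] norm_nonneg[of b] norm_nonneg[of "a + b"] by linarith
  ultimately show ?thesis by simp
qed

end

section \<open>The model groups\<close>

lemma normed_abelian_group_abs_real: "normed_abelian_group (\<lambda>x::real. \<bar>x\<bar>)"
  by unfold_locales auto

lemma complete_abs_real: "complete_normed_abelian_group (\<lambda>x::real. \<bar>x\<bar>)"
  unfolding complete_normed_abelian_group_iff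
proof (intro conjI allI impI)
  fix \<sigma> :: "nat \<Rightarrow> real"
  assume "\<forall>e>0. \<exists>K. \<forall>m\<ge>K. \<forall>n\<ge>K. \<bar>\<sigma> m - \<sigma> n\<bar> < e"
  then have "Cauchy \<sigma>" by (simp add: Cauchy_def dist_real_def)
  then obtain l where "\<sigma> \<longlonglongrightarrow> l" using Cauchy_convergent convergent_def by blast
  then show "\<exists>l. \<forall>e>0. \<exists>K. \<forall>n\<ge>K. \<bar>\<sigma> n - l\<bar> < e"
    unfolding lim_sequentially dist_real_def by blast
qed (rule normed_abelian_group_abs_real)

lemma collinear_abs_real: "collinear_zero_mean_triples (\<lambda>x::real. \<bar>x\<bar>)"
  unfolding normed_abelian_group.collinear_zero_mean_triples_iff[OF normed_abelian_group_abs_real]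
  by (auto simp: abs_if)

lemma normed_abelian_group_abs_int: "normed_abelian_group (\<lambda>k::int. real_of_int \<bar>k\<bar>)"
  by unfold_locales auto

lemma complete_abs_int: "complete_normed_abelian_group (\<lambda>k::int. real_of_int \<bar>k\<bar>)"
  by (rule complete_if_discrete[where e = 1, OF normed_abelian_group_abs_int]) auto

lemma collinear_abs_int: "collinear_zero_mean_triples (\<lambda>k::int. real_of_int \<bar>k\<bar>)"
  unfolding normed_abelian_group.collinear_zero_mean_triples_iff[OF normed_abelian_group_abs_int]
  by (auto simp: abs_if)

lemma Z2_cases: "(x::2) = 0 \<or> x = 1"
  using exhaust_2[of x] by auto

lemma two_eq_zero_Z2: "(2::2) = 0"
  by simp

lemma reduce_Z4: "(4::4) = 0" "(5::4) = 1" "(6::4) = 2"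
  by simp_all

lemma Z4_cases: "(x::4) = 0 \<or> x = 1 \<or> x = 2 \<or> x = 3"
  using exhaust_4[of x] by auto

lemma Z2xZ2_cases: "(x::2 \<times> 2) = (0, 0) \<or> x = (1, 0) \<or> x = (0, 1) \<or> x = (1, 1)"
  using Z2_cases[of "fst x"] Z2_cases[of "snd x"] by (cases x) auto

lemma collinear_Z2:
  fixes M :: "2 \<Rightarrow> real"
  assumes "normed_abelian_group M"
  shows "collinear_zero_mean_triples M"
proof -
  interpret normed_abelian_group M by fact
  have "M 0 = 0" by (simp add: norm_eq_zero)
  have "M (a + b) = M a + M b \<or> M (a + b) = \<bar>M a - M b\<bar>" for a b
    using Z2_cases[of a] Z2_cases[of b] \<open>M 0 = 0\<close> norm_nonneg[of 1]
    by (elim disjE) (simp_all add: two_eq_zero_Z2)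
  then show ?thesis unfolding collinear_zero_mean_triples_iff by blast
qed

lemma collinear_Z4:
  assumes "is_norm_Z4 M"
  shows "collinear_zero_mean_triples M"
proof -
  interpret normed_abelian_group M using assms by (simp add: is_norm_Z4_def)
  have "- (3::4) = 1" by simp
  then have "M 3 = M 1" using norm_minus[of 3] by metis
  then have vals: "M 0 = 0" "M 1 = 1" "M 2 = 2" "M 3 = 1"
    using assms unfolding is_norm_Z4_def by (simp_all add: norm_eq_zero)
  have "M (a + b) = M a + M b \<or> M (a + b) = \<bar>M a - M b\<bar>" for a b
    using Z4_cases[of a] Z4_cases[of b] by (elim disjE) (simp_all add: vals reduce_Z4)
  then show ?thesis unfolding collinear_zero_mean_triples_iff by blast
qed

lemma collinear_Z2xZ2:
  assumes "is_norm_Z2xZ2 \<alpha> M" "\<alpha> \<ge> 0"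
  shows "collinear_zero_mean_triples M"
proof -
  interpret normed_abelian_group M using assms by (simp add: is_norm_Z2xZ2_def)
  have vals: "M (0, 0) = 0" "M (1, 0) = 1" "M (0, 1) = \<alpha>" "M (1, 1) = 1 + \<alpha>"
    using assms by (simp_all add: is_norm_Z2xZ2_def norm_eq_zero zero_prod_def)
  have "M (a + b) = M a + M b \<or> M (a + b) = \<bar>M a - M b\<bar>" for a b
    using Z2xZ2_cases[of a] Z2xZ2_cases[of b] \<open>\<alpha> \<ge> 0\<close>
    by (elim disjE) (simp_all add: vals two_eq_zero_Z2)
  then show ?thesis unfolding collinear_zero_mean_triples_iff by blast
qed

lemma normed_Z2: "normed_abelian_group (\<lambda>x::2. if x = 0 then 0 else 1 :: real)"
proof
  fix g h :: 2
  show "(if g + h = 0 then 0 else 1 :: real) \<le> (if g = 0 then 0 else 1) + (if h = 0 then 0 else 1)"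
    using Z2_cases[of g] Z2_cases[of h] by (elim disjE) simp_all
qed simp_all

lemma is_norm_Z4_exists: "\<exists>M. is_norm_Z4 M"
proof
  define M :: "4 \<Rightarrow> real" where "M x = (if x = 0 then 0 else if x = 2 then 2 else 1)" for x
  have "normed_abelian_group M"
  proof
    fix g h :: 4
    show "M (g + h) \<le> M g + M h"
      using Z4_cases[of g] Z4_cases[of h] by (elim disjE) (simp_all add: M_def)
    show "M (- g) = M g"
      using Z4_cases[of g] by (elim disjE) (simp_all add: M_def)
  qed (simp_all add: M_def)
  then show "is_norm_Z4 M" by (simp add: is_norm_Z4_def M_def)
qed

lemma is_norm_Z2xZ2_exists:
  assumes "\<alpha> > 0"
  shows "\<exists>M. is_norm_Z2xZ2 \<alpha> M"
proof
  define M :: "2 \<times> 2 \<Rightarrow> real"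
    where "M x = (if fst x = 0 then 0 else 1) + (if snd x = 0 then 0 else \<alpha>)" for x
  have "normed_abelian_group M"
  proof
    fix g h :: "2 \<times> 2"
    show "M (g + h) \<le> M g + M h"
      using Z2xZ2_cases[of g] Z2xZ2_cases[of h] assms by (elim disjE) (simp_all add: M_def)
    show "0 \<le> M g" "M (- g) = M g" "M g = 0 \<longleftrightarrow> g = 0"
      using assms by (simp_all add: M_def prod_eq_iff)
  qed
  then show "is_norm_Z2xZ2 \<alpha> M" by (simp add: is_norm_Z2xZ2_def M_def)
qed

section \<open>Isomorphisms up to scaling\<close>

text \<open>
  Completeness and collinearity of a listed group are thereby reduced to those of its model.
\<close>

lemma norm_isomorphic_up_to_scaling_transfer:
  fixes N :: "'a::ab_group_add \<Rightarrow> real" and M :: "'b::ab_group_add \<Rightarrow> real"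
  assumes iso: "norm_isomorphic_up_to_scaling N M"
    and M: "complete_normed_abelian_group M" "collinear_zero_mean_triples M"
  shows "complete_normed_abelian_group N \<and> collinear_zero_mean_triples N"
proof -
  obtain c where "c > 0" and "norm_isomorphic (\<lambda>g. c * N g) M"
    using iso unfolding norm_isomorphic_up_to_scaling_def by blast
  then obtain f where f: "Modules.additive f" "bij f" and Mf: "\<And>g. M (f g) = c * N g"
    unfolding norm_isomorphic_def by blast
  interpret f: Modules.additive f by fact
  interpret M: normed_abelian_group M using M by (simp add: complete_normed_abelian_group_def)
  have N: "N g = M (f g) / c" for g
    using Mf[of g] \<open>c > 0\<close> by simp
  have normed: "normed_abelian_group N"
  proof
    fix g h
    show "0 \<le> N g" "N (- g) = N g"
      using \<open>c > 0\<close> by (simp_all add: N f.minus M.norm_minus M.norm_nonneg)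
    show "N (g + h) \<le> N g + N h"
      using divide_right_mono[OF M.norm_triangle[of "f g" "f h"], of c] \<open>c > 0\<close>
      by (simp add: N f.add add_divide_distrib)
    have "f g = 0 \<longleftrightarrow> g = 0"
      using inj_eq[OF bij_is_inj[OF f(2)], of g 0] f.zero by simp
    then show "N g = 0 \<longleftrightarrow> g = 0"
      using \<open>c > 0\<close> by (simp add: N M.norm_eq_zero)
  qed
  have "complete_normed_abelian_group N"
    unfolding complete_normed_abelian_group_iff
  proof (intro conjI allI impI)
    fix \<sigma> :: "nat \<Rightarrow> 'a" assume cau: "\<forall>e>0. \<exists>K. \<forall>m\<ge>K. \<forall>n\<ge>K. N (\<sigma> m - \<sigma> n) < e"
    have "\<forall>e>0. \<exists>K. \<forall>m\<ge>K. \<forall>n\<ge>K. M (f (\<sigma> m) - f (\<sigma> n)) < e"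
    proof (intro allI impI)
      fix e :: real assume "e > 0"
      then have "e / c > 0" using \<open>c > 0\<close> by simp
      with cau obtain K where "\<forall>m\<ge>K. \<forall>n\<ge>K. N (\<sigma> m - \<sigma> n) < e / c" by blast
      then show "\<exists>K. \<forall>m\<ge>K. \<forall>n\<ge>K. M (f (\<sigma> m) - f (\<sigma> n)) < e"
        using \<open>c > 0\<close> by (auto simp: N f.diff divide_less_cancel)
    qed
    then have "\<exists>l. \<forall>e>0. \<exists>K. \<forall>n\<ge>K. M (f (\<sigma> n) - l) < e"
      using M(1)[unfolded complete_normed_abelian_group_iff, THEN conjunct2,
          THEN spec[of _ "\<lambda>n. f (\<sigma> n)"]] by (rule mp[rotated])
    then obtain l where l: "\<forall>e>0. \<exists>K. \<forall>n\<ge>K. M (f (\<sigma> n) - l) < e" ..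
    obtain k where k: "l = f k" using bij_is_surj[OF f(2)] by blast
    show "\<exists>l. \<forall>e>0. \<exists>K. \<forall>n\<ge>K. N (\<sigma> n - l) < e"
    proof (intro exI[of _ k] allI impI)
      fix e :: real assume "e > 0"
      then have "e * c > 0" using \<open>c > 0\<close> by simp
      with l obtain K where "\<forall>n\<ge>K. M (f (\<sigma> n) - l) < e * c" by blast
      then show "\<exists>K. \<forall>n\<ge>K. N (\<sigma> n - k) < e"
        using \<open>c > 0\<close> by (auto simp: N k f.diff pos_divide_less_eq)
    qed
  qed (rule normed)
  moreover have "collinear_zero_mean_triples N"
    unfolding collinear_zero_mean_triples_def
  proof (intro allI impI)
    fix a b d :: 'a assume "zero_mean_triple a b d"
    then have "zero_mean_triple (f a) (f b) (f d)"
      unfolding zero_mean_triple_def by (metis f.add f.zero)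
    then have "collinear_triple M (f a) (f b) (f d)"
      using M(2) unfolding collinear_zero_mean_triples_def by blast
    then show "collinear_triple N a b d"
      using \<open>c > 0\<close> unfolding collinear_triple_def N by (simp flip: add_divide_distrib)
  qed
  ultimately show ?thesis ..
qed

text \<open>
  For the integers and the finite models the isomorphism is easier to define on the model, where the
  elements are explicit, than on the abstract group.
\<close>

lemma norm_isomorphic_up_to_scalingI:
  assumes "Modules.additive h" "bij h" "c > 0" "\<And>k. M k = c * N (h k)"
  shows "norm_isomorphic_up_to_scaling N M"
proof -
  interpret h: Modules.additive h by fact
  have h_inv: "h (inv h g) = g" for g
    using \<open>bij h\<close> by (simp add: bij_is_surj surj_f_inv_f)
  have "Modules.additive (inv h)"
  proof
    fix x y
    have "h (inv h (x + y)) = h (inv h x + inv h y)" by (simp add: h.add h_inv)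
    then show "inv h (x + y) = inv h x + inv h y" using \<open>bij h\<close> by (metis bij_is_inj injD)
  qed
  then show ?thesis
    unfolding norm_isomorphic_up_to_scaling_def norm_isomorphic_def
    using assms h_inv bij_imp_bij_inv[OF \<open>bij h\<close>] by metis
qed

text \<open>
  The model norm is obtained by transporting the given norm; \<open>c\<close> normalises it.
\<close>

lemma normed_abelian_group_pullback:
  assumes "normed_abelian_group N" "Modules.additive h" "inj h" "c > 0"
  shows "normed_abelian_group (\<lambda>k. c * N (h k))"
proof -
  interpret normed_abelian_group N by fact
  interpret h: Modules.additive h by fact
  show ?thesis
  proof
    fix k l
    show "0 \<le> c * N (h k)" "c * N (h (- k)) = c * N (h k)"
      using \<open>c > 0\<close> by (simp_all add: norm_nonneg h.minus norm_minus)
    show "c * N (h (k + l)) \<le> c * N (h k) + c * N (h l)"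
      using \<open>c > 0\<close> by (simp add: h.add norm_triangle flip: distrib_left)
    have "h k = 0 \<longleftrightarrow> k = 0" using \<open>inj h\<close> h.zero by (metis injD)
    then show "c * N (h k) = 0 \<longleftrightarrow> k = 0" using \<open>c > 0\<close> by (simp add: norm_eq_zero)
  qed
qed

section \<open>Closed subgroups of the reals\<close>

lemma additive_of_int_mult:
  fixes f :: "'a::ab_group_add \<Rightarrow> real"
  assumes "Modules.additive f"
  shows "of_int k * f g \<in> range f"
proof -
  interpret f: Modules.additive f by fact
  have nat: "real n * f g \<in> range f" for n
  proof (induction n)
    case 0
    show ?case using f.zero by (metis mult_zero_left of_nat_0 rangeI)
  next
    case (Suc n)
    then obtain x where "real n * f g = f x" by blast
    then have "real (Suc n) * f g = f (x + g)" by (simp add: f.add algebra_simps)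
    then show ?case by blast
  qed
  show ?thesis
  proof (cases "k \<ge> 0")
    case True
    then show ?thesis using nat[of "nat k"] by simp
  next
    case False
    then obtain x where "- of_int k * f g = f x" using nat[of "nat (- k)"] by auto
    then have "of_int k * f g = f (- x)" by (simp add: f.minus)
    then show ?thesis by blast
  qed
qed

text \<open>
  Subgroups of the reals appear as ranges of additive maps. If there are arbitrarily small positive
  elements, their integer multiples are dense. Otherwise two distinct elements have distance at least
  some \<open>e > 0\<close>, so there is a least positive element, and division with remainder by it shows that it
  generates the subgroup.
\<close>

lemma closed_additive_range_cases:
  fixes f :: "'a::ab_group_add \<Rightarrow> real"
  assumes add: "Modules.additive f" and closed: "closed (range f)" and "f a \<noteq> 0"
  obtains "range f = UNIV"
  | s where "s > 0" "range f = range (\<lambda>k::int. of_int k * s)"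
proof (cases "\<forall>e>0. \<exists>g. 0 < f g \<and> f g < e")
  case True
  have "x \<in> range f" for x
  proof -
    have "x \<in> closure (range f)"
      unfolding closure_approachable
    proof (intro allI impI)
      fix e :: real assume "e > 0"
      then obtain g where g: "0 < f g" "f g < e" using True by blast
      define y where "y = of_int \<lfloor>x / f g\<rfloor> * f g"
      have "y \<le> x" "x < y + f g"
        unfolding y_def using g(1) floor_divide_lower[OF g(1), of x] floor_divide_upper[OF g(1), of x]
        by (simp_all add: algebra_simps)
      then have "dist y x < e" using g(2) by (simp add: dist_real_def)
      moreover have "y \<in> range f" unfolding y_def by (rule additive_of_int_mult[OF add])
      ultimately show "\<exists>y\<in>range f. dist y x < e" by blast
    qed
    then show ?thesis using closed by simp
  qed
  then show thesis using that(1) by blast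
next
  case False
  interpret f: Modules.additive f by fact
  obtain e where "e > 0" and gap: "\<And>g. 0 < f g \<Longrightarrow> e \<le> f g"
    using False by (metis not_le)
  define P where "P = {f g | g. 0 < f g}"
  have "f a \<in> P \<or> f (- a) \<in> P"
    using \<open>f a \<noteq> 0\<close> unfolding P_def mem_Collect_eq
    by (metis f.minus linorder_neqE_linordered_idom neg_0_less_iff_less)
  then have "P \<noteq> {}" by blast
  moreover have "bdd_below P"
    unfolding P_def by (rule bdd_belowI[of _ 0]) auto
  \<comment> \<open>An element this close to the infimum attains it: a smaller positive one would differ from it by
      less than \<open>e\<close>.\<close>
  ultimately obtain s where "s \<in> P" "s < Inf P + e"
    using cInf_lessD[of P "Inf P + e"] \<open>e > 0\<close> by auto
  then obtain g where g: "s = f g" "0 < f g" unfolding P_def by blast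
  have least: "s \<le> f h" if "0 < f h" for h
  proof (rule ccontr)
    assume "\<not> s \<le> f h"
    then have "0 < f (g - h)" by (simp add: f.diff g)
    then have "e \<le> s - f h" using gap[of "g - h"] by (simp add: f.diff g)
    moreover have "Inf P \<le> f h"
      using that \<open>bdd_below P\<close> by (intro cInf_lower) (auto simp: P_def)
    ultimately show False using \<open>s < Inf P + e\<close> by linarith
  qed
  have "f h \<in> range (\<lambda>k::int. of_int k * s)" for h
  proof -
    define k where "k = \<lfloor>f h / s\<rfloor>"
    have "s > 0" using g by simp
    obtain x where x: "of_int k * s = f x"
      using additive_of_int_mult[OF add, of k g] g(1) by auto
    have "0 \<le> f (h - x)" "f (h - x) < s"
      using floor_divide_lower[OF \<open>s > 0\<close>, of "f h"] floor_divide_upper[OF \<open>s > 0\<close>, of "f h"] x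
      by (simp_all add: k_def f.diff algebra_simps)
    then have "f (h - x) = 0" using least[of "h - x"] by linarith
    then show ?thesis using x by (simp add: f.diff image_iff) metis
  qed
  moreover have "of_int k * s \<in> range f" for k
    unfolding g(1) by (rule additive_of_int_mult[OF add])
  ultimately have "range f = range (\<lambda>k::int. of_int k * s)" by blast
  then show thesis using that(2) g by simp
qed

section \<open>Elements of infinite order\<close>

primrec multiple :: "nat \<Rightarrow> 'a::ab_group_add \<Rightarrow> 'a" where
  "multiple 0 a = 0"
| "multiple (Suc n) a = multiple n a + a"

lemma multiple_add: "multiple (m + n) a = multiple m a + multiple n a"
  by (induction n) (simp_all add: algebra_simps)

locale collinear_normed_group = normed_abelian_group N for N :: "'a::ab_group_add \<Rightarrow> real" +
  assumes collinear: "N (a + b) = N a + N b \<or> N (a + b) = \<bar>N a - N b\<bar>"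
begin

lemma norm_zero [simp]: "N 0 = 0"
  by (simp add: norm_eq_zero)

lemma norm_pos: "g \<noteq> 0 \<Longrightarrow> 0 < N g"
  using norm_eq_zero[of g] norm_nonneg[of g] by linarith

lemma norm_double: "g + g \<noteq> 0 \<Longrightarrow> N (g + g) = 2 * N g"
  using collinear[of g g] norm_eq_zero[of "g + g"] by auto

text \<open>
  For \<open>n \<ge> 5\<close>, the decomposition \<open>(n - 1) + 1\<close> allows for \<open>|na|\<close> only the values \<open>n|a|\<close> and \<open>(n - 2)|a|\<close>, and
  \<open>(n - 2) + 2\<close> only \<open>n|a|\<close> and \<open>(n - 4)|a|\<close>, so \<open>|na| = n|a|\<close>. For \<open>n = 3\<close> the value \<open>|a|\<close> has to be excluded,
  which does occur in a cyclic group of order 4. Here \<open>4a \<noteq> 0\<close> gives \<open>|4a| = 4|a|\<close> by doubling twice, and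
  \<open>4a = 3a + a\<close> then needs \<open>|3a| \<ge> 3|a|\<close>.
\<close>

lemma norm_multiple:
  assumes "multiple 4 a \<noteq> 0"
  shows "N (multiple n a) = n * N a"
proof -
  have four: "multiple 4 a = (a + a) + (a + a)" by (simp add: eval_nat_numeral algebra_simps)
  have "a \<noteq> 0" "a + a \<noteq> 0" using assms four by auto
  then have pos: "N a > 0" and N2: "N (multiple 2 a) = 2 * N a"
    using norm_pos norm_double[of a] by (simp_all add: eval_nat_numeral)
  have N4: "N (multiple 4 a) = 4 * N a"
    using assms norm_double[of "a + a"] norm_double[of a] \<open>a + a \<noteq> 0\<close> four by simp
  have N3: "N (multiple 3 a) = 3 * N a"
    using collinear[of "multiple 2 a" a] collinear[of "multiple 3 a" a] N2 N4 pos
    by (simp add: eval_nat_numeral) linarith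
  show ?thesis
  proof (induction n rule: less_induct)
    case (less n)
    consider "n = 0" | "n = 1" | "n = 2" | "n = 3" | "n = 4" | "n \<ge> 5"
      by linarith
    then show ?case
    proof cases
      case 6
      define m where "m = n - 5"
      with 6 have n: "n = m + 5" by simp
      have "N (multiple (m + 4) a) = (m + 4) * N a" "N (multiple (m + 3) a) = (m + 3) * N a"
        using less.IH[of "m + 4"] less.IH[of "m + 3"] n by simp_all
      moreover have "multiple n a = multiple (m + 4) a + a"
          "multiple n a = multiple (m + 3) a + multiple 2 a"
        unfolding n multiple_add by (simp_all add: eval_nat_numeral algebra_simps)
      moreover have "real m * N a \<ge> 0" using pos by simp
      ultimately show ?thesis
        using collinear[of "multiple (m + 4) a" a] collinear[of "multiple (m + 3) a" "multiple 2 a"]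
          N2 pos unfolding n by (simp add: algebra_simps) linarith
    qed (use N2 N3 N4 in simp_all)
  qed
qed

text \<open>
  The map is the Busemann function of the ray of multiples of \<open>a\<close>. The sequence defining it decreases by
  the triangle inequality and is bounded below by \<open>- |g|\<close>, so the limit exists.
\<close>

lemma isometric_additive_real:
  fixes a :: 'a
  assumes a: "multiple 4 a \<noteq> 0"
  obtains f :: "'a \<Rightarrow> real" where "Modules.additive f" "\<And>g. \<bar>f g\<bar> = N g"
proof
  define s where "s g n = N (g + multiple n a) - n * N a" for g n
  define f where "f g = lim (s g)" for g
  have "a \<noteq> 0" using a by (auto simp: eval_nat_numeral)
  then have pos: "N a > 0" by (rule norm_pos)
  have dec: "decseq (s g)" for g
  proof (rule decseq_SucI)
    show "s g (Suc n) \<le> s g n" for n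
      using norm_triangle[of "g + multiple n a" a] by (simp add: s_def algebra_simps)
  qed
  have lower: "- N g \<le> s g n" for g n
    using norm_triangle[of "g + multiple n a" "- g"] norm_multiple[OF a, of n]
    by (simp add: s_def norm_minus)
  have lim: "s g \<longlonglongrightarrow> f g" for g
    unfolding f_def
    by (metis convergent_LIMSEQ_iff convergent_def dec decseq_convergent lower)
  have s_le: "f g \<le> s g n" for g n
    using dec lim by (rule decseq_ge)
  have abs: "\<bar>f g\<bar> = N g" for g
  proof -
    \<comment> \<open>As soon as \<open>n|a|\<close> exceeds \<open>|g|\<close>, collinearity leaves only two values for the sequence.\<close>
    obtain K :: nat where K: "N g / N a < K" using reals_Archimedean2 by blast
    have "\<bar>s g n\<bar> = N g" if "n \<ge> K" for n
    proof -
      have "N g < K * N a" using K pos by (simp add: divide_less_eq)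
      also have "\<dots> \<le> n * N a" using that pos by simp
      finally show ?thesis
        using collinear[of g "multiple n a"] norm_nonneg[of g]
        unfolding norm_multiple[OF a] s_def by linarith
    qed
    then have "\<forall>\<^sub>F n in sequentially. \<bar>s g n\<bar> = N g"
      using eventually_sequentially by blast
    then have "(\<lambda>n. \<bar>s g n\<bar>) \<longlonglongrightarrow> N g" by (rule tendsto_eventually)
    then show ?thesis using tendsto_rabs[OF lim[of g]] LIMSEQ_unique by blast
  qed
  show "\<bar>f g\<bar> = N g" for g by (rule abs)
  have subadd: "f (g + h) \<le> f g + f h" for g h
  proof (rule LIMSEQ_le)
    \<comment> \<open>The even-indexed subsequence is compared, since \<open>n\<close> steps are spent on each summand.\<close>
    show "(\<lambda>n. s (g + h) (n + n)) \<longlonglongrightarrow> f (g + h)"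
      using LIMSEQ_subseq_LIMSEQ[OF lim[of "g + h"], of "\<lambda>n. n + n"]
      by (simp add: strict_mono_def o_def)
    show "(\<lambda>n. s g n + s h n) \<longlonglongrightarrow> f g + f h" by (intro tendsto_add lim)
    have "s (g + h) (n + n) \<le> s g n + s h n" for n
      using norm_triangle[of "g + multiple n a" "h + multiple n a"]
      by (simp add: s_def multiple_add algebra_simps)
    then show "\<exists>K. \<forall>n\<ge>K. s (g + h) (n + n) \<le> s g n + s h n" by blast
  qed
  have odd: "f (- g) = - f g" for g
  proof (rule ccontr)
    assume "f (- g) \<noteq> - f g"
    moreover have "f g + f (- g) \<ge> 0"
      using subadd[of g "- g"] abs[of 0] by simp
    ultimately have "f g = N g" "f (- g) = N g" "N g > 0"
      using abs[of g] abs[of "- g"] norm_minus[of g] by linarith+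
    \<comment> \<open>The decreasing sequences have their largest possible limits, hence are constant; but then \<open>2a\<close>
        is a sum of two elements of norm \<open>|g| + |a|\<close>, and no such sum can have norm \<open>2|a|\<close>.\<close>
    then have "N (g + a) \<ge> N g + N a" "N (- g + a) \<ge> N g + N a"
      using s_le[of g 1] s_le[of "- g" 1] by (simp_all add: s_def)
    then have "N (g + a) = N g + N a" "N (- g + a) = N g + N a"
      using norm_triangle[of g a] norm_triangle[of "- g" a] norm_minus[of g] by linarith+
    moreover have "(g + a) + (- g + a) = multiple 2 a"
      by (simp add: eval_nat_numeral)
    ultimately show False
      using collinear[of "g + a" "- g + a"] norm_multiple[OF a, of 2] pos \<open>N g > 0\<close> by simp
  qed
  show "Modules.additive f"
  proof
    fix g h
    show "f (g + h) = f g + f h"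
      using subadd[of g h] subadd[of "- g" "- h"] odd[of g] odd[of h] odd[of "g + h"]
      by (simp add: algebra_simps)
  qed
qed

lemma closed_range_isometric:
  assumes compl: "complete_normed_abelian_group N"
    and add: "Modules.additive f" and abs: "\<And>g. \<bar>f g\<bar> = N g"
  shows "closed (range f)"
proof (rule complete_imp_closed, unfold complete_def, intro allI impI)
  interpret f: Modules.additive f by fact
  have dist: "dist (f g) (f h) = N (g - h)" for g h
    by (simp add: dist_real_def abs flip: f.diff)
  fix u assume u: "(\<forall>n. u n \<in> range f) \<and> Cauchy u"
  then have "\<forall>n. \<exists>g. u n = f g" by blast
  then obtain \<sigma> where \<sigma>: "\<And>n. u n = f (\<sigma> n)" by metis
  have "\<forall>e>0. \<exists>K. \<forall>m\<ge>K. \<forall>n\<ge>K. N (\<sigma> m - \<sigma> n) < e"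
    using u unfolding Cauchy_def \<sigma> dist by blast
  then obtain l where "\<forall>e>0. \<exists>K. \<forall>n\<ge>K. N (\<sigma> n - l) < e"
    using compl unfolding complete_normed_abelian_group_iff by blast
  then have "u \<longlonglongrightarrow> f l" unfolding lim_sequentially \<sigma> dist .
  then show "\<exists>l\<in>range f. u \<longlonglongrightarrow> l" by blast
qed

lemma real_or_int:
  fixes a :: 'a
  assumes compl: "complete_normed_abelian_group N" and a: "multiple 4 a \<noteq> 0"
  shows "norm_isomorphic_up_to_scaling N (\<lambda>x::real. \<bar>x\<bar>) \<or>
    norm_isomorphic_up_to_scaling N (\<lambda>k::int. real_of_int \<bar>k\<bar>)"
proof -
  obtain f :: "'a \<Rightarrow> real" where add: "Modules.additive f" and abs: "\<And>g. \<bar>f g\<bar> = N g"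
    using isometric_additive_real[OF a] by blast
  interpret f: Modules.additive f by fact
  have "g = h" if "f g = f h" for g h
    using that abs[of "g - h"] norm_eq_zero[of "g - h"] by (simp add: f.diff)
  then have "inj f" by (rule injI)
  have "a \<noteq> 0" using a by (auto simp: eval_nat_numeral)
  then have "f a \<noteq> 0" using abs[of a] norm_pos by force
  from add closed_range_isometric[OF compl add abs] this show ?thesis
  proof (cases rule: closed_additive_range_cases)
    case 1
    then have "bij f" using \<open>inj f\<close> by (simp add: bij_def)
    then have "norm_isomorphic_up_to_scaling N (\<lambda>x::real. \<bar>x\<bar>)"
      unfolding norm_isomorphic_up_to_scaling_def norm_isomorphic_def
      using add abs by (intro exI[of _ 1] exI[of _ f] conjI) simp_all
    then show ?thesis ..
  next
    case (2 s)
    define h where "h k = inv f (of_int k * s)" for k :: int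
    have fh: "f (h k) = of_int k * s" for k
      unfolding h_def by (rule f_inv_into_f) (unfold 2, blast)
    have "norm_isomorphic_up_to_scaling N (\<lambda>k::int. real_of_int \<bar>k\<bar>)"
    proof (rule norm_isomorphic_up_to_scalingI)
      show "Modules.additive h"
      proof
        fix k l
        have "f (h (k + l)) = f (h k + h l)" by (simp add: f.add fh algebra_simps)
        then show "h (k + l) = h k + h l" using \<open>inj f\<close> by (metis injD)
      qed
      have "inj h"
      proof (rule injI)
        fix k l assume "h k = h l"
        then have "of_int k * s = of_int l * s" using fh by metis
        then show "k = l" using \<open>s > 0\<close> by simp
      qed
      moreover have "g \<in> range h" for g
      proof -
        have "f g \<in> range (\<lambda>k::int. of_int k * s)" unfolding 2(2)[symmetric] by (rule rangeI)
        then obtain k :: int where "f g = of_int k * s" by blast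
        then have "f g = f (h k)" by (simp add: fh)
        then show ?thesis using \<open>inj f\<close> by (metis injD rangeI)
      qed
      ultimately show "bij h" by (auto simp: bij_def)
      show "1 / s > 0" using 2 by simp
      show "real_of_int \<bar>k\<bar> = 1 / s * N (h k)" for k
        using \<open>s > 0\<close> unfolding abs[symmetric] fh by (simp add: abs_mult)
    qed
    then show ?thesis ..
  qed
qed

section \<open>Groups of exponent 4\<close>

text \<open>
  If \<open>g\<close> has order 2, then \<open>2(a + g) = 2a\<close>, so \<open>a + g\<close> has the same norm as \<open>a\<close>, and collinearity forces
  \<open>|g| = 2|a|\<close>. All elements of order 2 thus have one norm \<open>r > 0\<close>, while by collinearity the sum of two
  of them has norm \<open>0\<close> or \<open>2r\<close>; hence \<open>2a\<close> is the only one. Since twice any element is \<open>0\<close> or \<open>2a\<close>, the element or its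
  difference with \<open>a\<close> is \<open>0\<close> or \<open>2a\<close>.
\<close>

lemma exponent_four_elements:
  fixes a g :: 'a
  assumes exp: "\<And>g::'a. (g + g) + (g + g) = 0" and a: "a + a \<noteq> 0"
  shows "g \<in> {0, a, a + a, a + a + a}"
proof -
  define t where "t = a + a"
  have "t \<noteq> 0" "t + t = 0" using a exp by (simp_all add: t_def)
  have Nt: "N t = 2 * N a" "N a > 0"
    using norm_double[OF a] norm_pos[of a] norm_pos[OF a] by (auto simp: t_def)
  have involution: "N g = N t" if "g + g = 0" "g \<noteq> 0" for g
  proof -
    have "(a + g) + (a + g) = t" using that by (simp add: t_def algebra_simps)
    then have "N t = 2 * N (a + g)" using norm_double[of "a + g"] \<open>t \<noteq> 0\<close> by simp
    then show ?thesis using collinear[of a g] Nt norm_pos[OF that(2)] by linarith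
  qed
  have two_torsion: "g = 0 \<or> g = t" if "g + g = 0" for g
  proof (rule ccontr)
    assume "\<not> (g = 0 \<or> g = t)"
    then have "g \<noteq> 0" "g + t \<noteq> 0"
      using \<open>t + t = 0\<close> by (auto simp: eq_neg_iff_add_eq_0[symmetric])
    moreover have "(g + t) + (g + t) = 0"
      using that \<open>t + t = 0\<close> by (simp add: algebra_simps)
    ultimately have "N g = N t" "N (g + t) = N t" using involution that by blast+
    then show False using collinear[of g t] Nt by linarith
  qed
  have "g + g = 0 \<or> g + g = t" using two_torsion exp by blast
  then show ?thesis
  proof
    assume "g + g = 0"
    then show ?thesis using two_torsion t_def by auto
  next
    assume "g + g = t"
    then have "(g - a) + (g - a) = 0" by (simp add: t_def algebra_simps)
    then have "g - a = 0 \<or> g - a = t" by (rule two_torsion)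
    then show ?thesis by (auto simp: t_def algebra_simps)
  qed
qed

lemma Z4_if_exponent_four:
  fixes a :: 'a
  assumes exp: "\<And>g::'a. multiple 4 g = 0" and a: "a + a \<noteq> 0"
  shows "\<exists>M. is_norm_Z4 M \<and> norm_isomorphic_up_to_scaling N M"
proof -
  have exp': "(g + g) + (g + g) = 0" for g :: 'a
    using exp[of g] by (simp add: eval_nat_numeral algebra_simps)
  define h :: "4 \<Rightarrow> 'a" where
    "h k = (if k = 0 then 0 else if k = 1 then a else if k = 2 then a + a else a + a + a)" for k
  have "a \<noteq> 0" using a by auto
  then have pos: "N a > 0" by (rule norm_pos)
  have red: "a + (a + (a + a)) = 0" using exp'[of a] by (simp add: add.assoc)
  have red': "a + (a + (a + (a + x))) = x" for x
    using arg_cong[OF red, of "\<lambda>y. y + x"] by (simp add: add.assoc)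
  have add: "Modules.additive h"
  proof
    show "h (k + l) = h k + h l" for k l
      using Z4_cases[of k] Z4_cases[of l]
      by (elim disjE) (simp_all add: h_def add.assoc red red' reduce_Z4)
  qed
  interpret h: Modules.additive h by fact
  have ne: "a \<noteq> 0" "a + (a + a) \<noteq> 0"
    using a red by auto
  have "k = 0" if "h k = 0" for k
    using that a ne Z4_cases[of k] by (auto simp: h_def add.assoc split: if_splits)
  then have "inj h"
    by (intro injI) (metis eq_iff_diff_eq_0 h.diff)
  have "g \<in> range h" for g
  proof -
    have "h 0 = 0" "h 1 = a" "h 2 = a + a" "h 3 = a + a + a" by (simp_all add: h_def)
    then show ?thesis using exponent_four_elements[OF exp' a, of g]
      by (metis insertE empty_iff rangeI)
  qed
  then have "bij h" using \<open>inj h\<close> by (auto simp: bij_def)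
  define M where "M k = 1 / N a * N (h k)" for k
  have "is_norm_Z4 M"
    unfolding is_norm_Z4_def M_def
    using normed_abelian_group_pullback[OF normed_abelian_group_axioms add \<open>inj h\<close>, of "1 / N a"]
      pos norm_double[OF a] by (simp add: h_def)
  moreover have "norm_isomorphic_up_to_scaling N M"
    using add \<open>bij h\<close> pos
    by (intro norm_isomorphic_up_to_scalingI[of h "1 / N a"]) (simp_all add: M_def)
  ultimately show ?thesis by blast
qed

section \<open>Groups of exponent 2\<close>

text \<open>
  Let \<open>m\<close> have the largest norm \<open>M\<close> in a Fano plane spanned by \<open>m, p, q\<close>. On each of the three lines
  through \<open>m\<close>, the other two norms add up to \<open>M\<close>; write them as \<open>M/2 \<plusminus> u'\<close>, \<open>M/2 \<plusminus> v'\<close> and \<open>M/2 \<plusminus> w'\<close>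
  with \<open>|u'|, |v'|, |w'| < M/2\<close>. Each of the four lines that avoid \<open>m\<close> takes one point from each of these
  pairs, and its collinearity becomes an equation \<open>\<plusminus> u' \<plusminus> v' \<plusminus> w' = M/2\<close> with an even number of minus
  signs. There are four such sign patterns, and each of the four lines rules out a different one, so
  at least two patterns occur. Two different patterns agree in exactly one sign, and adding their
  equations gives \<open>\<plusminus> 2u' = M\<close>, or the same with \<open>v'\<close> or \<open>w'\<close>, which contradicts the bounds.
\<close>

lemma exponent_two_no_maximum:
  fixes m p q :: 'a
  assumes exp: "\<And>g::'a. g + g = 0"
    and indep: "m \<noteq> 0" "p \<noteq> 0" "p \<noteq> m" "q \<notin> {0, p, m, p + m}"
    and max: "N p \<le> N m" "N (p + m) \<le> N m" "N q \<le> N m" "N (q + m) \<le> N m"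
      "N (p + q) \<le> N m" "N (p + q + m) \<le> N m"
  shows False
proof -
  have cancel: "x + (x + y) = y" for x y :: 'a using exp[of x] by (simp flip: add.assoc)
  have ne: "x \<noteq> y \<Longrightarrow> x + y \<noteq> 0" for x y :: 'a
    using exp by (metis add_left_cancel)
  have nz: "q \<noteq> 0" "p + m \<noteq> 0" "q + m \<noteq> 0" "p + q \<noteq> 0" "p + q + m \<noteq> 0"
    using indep ne[of p m] ne[of q m] ne[of p q] ne[of q "p + m"] by (auto simp: ac_simps)
  have through: "N x + N (x + m) = N m"
    if "x \<noteq> 0" "x + m \<noteq> 0" "N x \<le> N m" "N (x + m) \<le> N m" for x
    using collinear[of x "x + m"] cancel[of x m] norm_pos[OF that(1)] norm_pos[OF that(2)] that(3,4)
    by auto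
  define M where "M = N m"
  define u v w where "u = N p" and "v = N q" and "w = N (p + q)"
  have comp: "N (p + m) = M - u" "N (q + m) = M - v" "N (p + q + m) = M - w"
    using through[of p] through[of q] through[of "p + q"] nz indep max
    by (simp_all add: M_def u_def v_def w_def add.assoc)
  have sums: "(p + m) + (q + m) = p + q" "p + (q + m) = p + q + m" "(p + m) + q = p + q + m"
    using cancel by (simp_all add: ac_simps)
  have bounds: "0 < u" "u < M" "0 < v" "v < M" "0 < w" "w < M"
    using norm_pos nz indep comp unfolding u_def v_def w_def by (smt (verit))+
  have line1: "w = u + v \<or> w = u - v \<or> w = v - u"
    using collinear[of p q] unfolding u_def v_def w_def by linarith
  have line2: "w = (M - u) + (M - v) \<or> w = (M - u) - (M - v) \<or> w = (M - v) - (M - u)"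
    using collinear[of "p + m" "q + m"] unfolding sums comp w_def by linarith
  have line3: "M - w = u + (M - v) \<or> M - w = u - (M - v) \<or> M - w = (M - v) - u"
    using collinear[of p "q + m"] unfolding sums comp u_def by linarith
  have line4: "M - w = (M - u) + v \<or> M - w = (M - u) - v \<or> M - w = v - (M - u)"
    using collinear[of "p + m" q] unfolding sums comp v_def by linarith
  show False
    using line1 line2 line3 line4 bounds by linarith
qed

text \<open>
  A fourth element outside \<open>{0, x, y, x + y}\<close> spans with \<open>x\<close> and \<open>y\<close> a subgroup of eight elements, which
  contains a Fano plane with a point \<open>m\<close> of largest norm.
\<close>

lemma exponent_two_elements:
  fixes x y z :: 'a
  assumes exp: "\<And>g::'a. g + g = 0" and xy: "x \<noteq> 0" "y \<noteq> 0" "x \<noteq> y"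
  shows "z \<in> {0, x, y, x + y}"
proof (rule ccontr)
  assume z: "z \<notin> {0, x, y, x + y}"
  have cancel: "a + (a + b) = b" for a b :: 'a using exp[of a] by (simp flip: add.assoc)
  define H where "H = {0, x, y, z, x + y, x + z, y + z, x + (y + z)}"
  have H_add: "a + b \<in> H" if "a \<in> H" "b \<in> H" for a b :: 'a
    using that unfolding H_def by (auto simp: ac_simps cancel exp)
  have "finite (N ` H)" "N ` H \<noteq> {}" by (simp_all add: H_def)
  then have "Max (N ` H) \<in> N ` H" by (rule Max_in)
  then obtain m where "m \<in> H" and m: "Max (N ` H) = N m" by blast
  have max: "N g \<le> N m" if "g \<in> H" for g
    unfolding m[symmetric] using \<open>finite (N ` H)\<close> that by simp
  have "m \<noteq> 0"
    using max[of x] norm_pos[OF xy(1)] by (auto simp: H_def)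
  obtain p where p: "p \<in> H" "p \<noteq> 0" "p \<noteq> m"
    using xy by (cases "x = m") (auto simp: H_def)
  have "x + y \<noteq> 0" using xy(3) exp by (metis add_left_cancel)
  then have "card {0, x, y, x + y, z} = 5" using xy z by auto
  moreover have "card {0, p, m, p + m} \<le> 4"
    by (simp add: card_insert_if)
  \<comment> \<open>Five elements do not fit into the span of \<open>p\<close> and \<open>m\<close>, so a third independent element exists.\<close>
  ultimately have "\<not> card {0, x, y, x + y, z} \<le> card {0, p, m, p + m}" by linarith
  then have "\<not> {0, x, y, x + y, z} \<subseteq> {0, p, m, p + m}"
    by (meson card_mono finite.emptyI finite.insertI)
  then obtain q where q: "q \<in> H" "q \<notin> {0, p, m, p + m}"
    unfolding H_def by blast
  show False
    by (rule exponent_two_no_maximum[OF exp \<open>m \<noteq> 0\<close> p(2,3) q(2)])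
      (intro max H_add p q \<open>m \<in> H\<close>)+
qed

lemma Z2_if_two_elements:
  fixes x :: 'a
  assumes "x \<noteq> 0" and elements: "\<And>g. g = 0 \<or> g = x"
  shows "\<exists>M :: 2 \<Rightarrow> real. normed_abelian_group M \<and> norm_isomorphic_up_to_scaling N M"
proof -
  define h :: "2 \<Rightarrow> 'a" where "h k = (if k = 0 then 0 else x)" for k
  have "x + x = 0" using elements[of "x + x"] \<open>x \<noteq> 0\<close> by auto
  have add: "Modules.additive h"
  proof
    show "h (k + l) = h k + h l" for k l
      using Z2_cases[of k] Z2_cases[of l] \<open>x + x = 0\<close>
      by (elim disjE) (simp_all add: h_def two_eq_zero_Z2)
  qed
  have "inj h"
    using \<open>x \<noteq> 0\<close> Z2_cases by (intro injI) (metis h_def)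
  moreover have "g \<in> range h" for g
  proof -
    have "h 0 = 0" "h 1 = x" by (simp_all add: h_def)
    then show ?thesis using elements[of g] by (metis rangeI)
  qed
  ultimately have "bij h" by (auto simp: bij_def)
  then have "norm_isomorphic_up_to_scaling N (\<lambda>k. 1 * N (h k))"
    using add by (intro norm_isomorphic_up_to_scalingI[of h 1]) simp_all
  moreover have "normed_abelian_group (\<lambda>k. 1 * N (h k))"
    using normed_abelian_group_axioms add \<open>inj h\<close> by (rule normed_abelian_group_pullback) simp
  ultimately show ?thesis by blast
qed

lemma Z2xZ2_if_exponent_two:
  fixes x y :: 'a
  assumes exp: "\<And>g::'a. g + g = 0" and xy: "x \<noteq> 0" "y \<noteq> 0" "x \<noteq> y"
  shows "\<exists>\<alpha>\<ge>1. \<exists>M. is_norm_Z2xZ2 \<alpha> M \<and> norm_isomorphic_up_to_scaling N M"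
proof -
  have cancel: "a + (a + b) = b" for a b :: 'a using exp[of a] by (simp flip: add.assoc)
  have ne: "a + b \<noteq> 0" if "a \<noteq> b" for a b :: 'a using that exp by (metis add_left_cancel)
  \<comment> \<open>The largest of the three norms is the sum of the others, so the two others can serve as basis,
      with the shorter element first.\<close>
  obtain p q where pq: "p \<noteq> 0" "q \<noteq> 0" "p \<noteq> q" "N p \<le> N q" "N (p + q) = N p + N q"
  proof -
    have "\<exists>a b. a \<noteq> 0 \<and> b \<noteq> 0 \<and> a \<noteq> b \<and> N (a + b) = N a + N b"
    proof -
      consider "N (x + y) = N x + N y" | "N x = N y + N (x + y)" | "N y = N x + N (x + y)"
        using collinear[of x y] by linarith
      then show ?thesis
      proof cases
        case 1
        then show ?thesis using xy by blast
      next
        case 2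
        then have "N (y + (x + y)) = N y + N (x + y)" by (simp add: ac_simps cancel exp)
        then show ?thesis using xy ne[of x y] by (metis add_cancel_left_left)
      next
        case 3
        then have "N (x + (x + y)) = N x + N (x + y)" by (simp add: cancel)
        then show ?thesis using xy ne[of x y] by (metis add_cancel_left_right)
      qed
    qed
    then obtain a b where "a \<noteq> 0" "b \<noteq> 0" "a \<noteq> b" "N (a + b) = N a + N b" by blast
    then show thesis using that[of a b] that[of b a] by (cases "N a \<le> N b") (auto simp: ac_simps)
  qed
  define h :: "2 \<times> 2 \<Rightarrow> 'a"
    where "h k = (if fst k = 0 then 0 else p) + (if snd k = 0 then 0 else q)" for k
  have add: "Modules.additive h"
  proof
    show "h (k + l) = h k + h l" for k l
      using Z2xZ2_cases[of k] Z2xZ2_cases[of l]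
      by (elim disjE) (simp_all add: h_def two_eq_zero_Z2 ac_simps exp cancel)
  qed
  interpret h: Modules.additive h by fact
  have "k = 0" if "h k = 0" for k
    using that pq ne[of p q] Z2xZ2_cases[of k] by (auto simp: h_def zero_prod_def)
  then have "inj h"
    by (intro injI) (metis eq_iff_diff_eq_0 h.diff)
  have h_values: "h (0, 0) = 0" "h (1, 0) = p" "h (0, 1) = q" "h (1, 1) = p + q"
    by (simp_all add: h_def)
  have "g \<in> range h" for g
    using exponent_two_elements[OF exp pq(1-3), of g] h_values
    by (metis insertE empty_iff rangeI)
  then have "bij h" using \<open>inj h\<close> by (auto simp: bij_def)
  have "N p > 0" using pq norm_pos by blast
  define M where "M k = 1 / N p * N (h k)" for k
  have "normed_abelian_group M"
    unfolding M_def using normed_abelian_group_axioms add \<open>inj h\<close> \<open>N p > 0\<close>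
    by (intro normed_abelian_group_pullback) simp_all
  then have "is_norm_Z2xZ2 (N q / N p) M"
    unfolding is_norm_Z2xZ2_def M_def h_values pq(5) using \<open>N p > 0\<close> by (simp add: add_divide_distrib)
  moreover have "norm_isomorphic_up_to_scaling N M"
    using add \<open>bij h\<close> \<open>N p > 0\<close>
    by (intro norm_isomorphic_up_to_scalingI[of h "1 / N p"]) (simp_all add: M_def)
  moreover have "N q / N p \<ge> 1" using pq(4) \<open>N p > 0\<close> by simp
  ultimately show ?thesis by blast
qed

end

section \<open>The classification\<close>

theorem proposition1p10:
  fixes N :: "'a::ab_group_add \<Rightarrow> real"
  shows "(complete_normed_abelian_group (\<lambda>x::real. \<bar>x\<bar>) \<and>
          collinear_zero_mean_triples (\<lambda>x::real. \<bar>x\<bar>)) \<and>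
         (complete_normed_abelian_group (\<lambda>k::int. real_of_int \<bar>k\<bar>) \<and>
          collinear_zero_mean_triples (\<lambda>k::int. real_of_int \<bar>k\<bar>)) \<and>
         (\<exists>M :: 2 \<Rightarrow> real.
            complete_normed_abelian_group M \<and> collinear_zero_mean_triples M) \<and>
         (\<exists>M. is_norm_Z4 M \<and>
            complete_normed_abelian_group M \<and> collinear_zero_mean_triples M) \<and>
         (\<forall>\<alpha>\<ge>1. \<exists>M. is_norm_Z2xZ2 \<alpha> M \<and>
            complete_normed_abelian_group M \<and> collinear_zero_mean_triples M) \<and>
         ((\<exists>g::'a. g \<noteq> 0) \<longrightarrow>
          (complete_normed_abelian_group N \<and> collinear_zero_mean_triples N \<longleftrightarrow>
             norm_isomorphic_up_to_scaling N (\<lambda>x::real. \<bar>x\<bar>) \<or>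
             norm_isomorphic_up_to_scaling N (\<lambda>k::int. real_of_int \<bar>k\<bar>) \<or>
             (\<exists>M :: 2 \<Rightarrow> real. normed_abelian_group M \<and> norm_isomorphic_up_to_scaling N M) \<or>
             (\<exists>M. is_norm_Z4 M \<and> norm_isomorphic_up_to_scaling N M) \<or>
             (\<exists>\<alpha>\<ge>1. \<exists>M. is_norm_Z2xZ2 \<alpha> M \<and> norm_isomorphic_up_to_scaling N M)))"
proof (intro conjI allI impI, goal_cases)
  case 5
  then show ?case
    using normed_Z2 complete_if_finite collinear_Z2 by blast
next
  case 6
  then show ?case
    using is_norm_Z4_exists complete_if_finite collinear_Z4 unfolding is_norm_Z4_def by metis
next
  case (7 \<alpha>)
  then have "\<alpha> > 0" "\<alpha> \<ge> 0" by simp_all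
  then show ?case
    using is_norm_Z2xZ2_exists complete_if_finite collinear_Z2xZ2 unfolding is_norm_Z2xZ2_def by metis
next
  case 8
  show ?case (is "?L \<longleftrightarrow> ?R")
  proof
    assume ?L
    then have compl: "complete_normed_abelian_group N" and "normed_abelian_group N"
      by (simp_all add: complete_normed_abelian_group_def)
    interpret normed_abelian_group N by fact
    interpret collinear_normed_group N
      using \<open>?L\<close> by unfold_locales (simp add: collinear_zero_mean_triples_iff)
    show ?R
    proof (cases "(\<exists>a::'a. multiple 4 a \<noteq> 0) \<or> (\<exists>a::'a. a + a \<noteq> 0)")
      case True
      then show ?thesis using real_or_int[OF compl] Z4_if_exponent_four by blast
    next
      case False
      then have exp: "g + g = 0" for g :: 'a by blast
      obtain x :: 'a where "x \<noteq> 0" using 8 by blast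
      then show ?thesis
        using Z2xZ2_if_exponent_two[OF exp \<open>x \<noteq> 0\<close>] Z2_if_two_elements[OF \<open>x \<noteq> 0\<close>] by metis
    qed
  next
    assume ?R
    then show ?L
    proof (elim disjE exE conjE)
      fix M :: "2 \<Rightarrow> real"
      assume "normed_abelian_group M" "norm_isomorphic_up_to_scaling N M"
      then show ?L
        using norm_isomorphic_up_to_scaling_transfer complete_if_finite collinear_Z2 by blast
    next
      fix M assume "is_norm_Z4 M" "norm_isomorphic_up_to_scaling N M"
      then show ?L
        using norm_isomorphic_up_to_scaling_transfer complete_if_finite collinear_Z4
        unfolding is_norm_Z4_def by metis
    next
      fix \<alpha> M assume "1 \<le> \<alpha>" "is_norm_Z2xZ2 \<alpha> M" "norm_isomorphic_up_to_scaling N M"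
      moreover from this have "\<alpha> \<ge> 0" by simp
      ultimately show ?L
        using norm_isomorphic_up_to_scaling_transfer complete_if_finite collinear_Z2xZ2
        unfolding is_norm_Z2xZ2_def by metis
    qed (use norm_isomorphic_up_to_scaling_transfer complete_abs_real collinear_abs_real
        complete_abs_int collinear_abs_int in blast)+
  qed
qed (rule complete_abs_real collinear_abs_real complete_abs_int collinear_abs_int)+

end
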